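(* Let $(X,\Sigma,\mu)$ be a $\sigma$-finite measure space and let $\phi:X\to X$ be a measurable map with $\mu\circ\phi^{-1}\ll\mu$. Let $C_\phi$ be the composition operator in $L^2(\mu)$, let $h_0=1$ and $h_i=\frac{d(\mu\circ\phi^{-i})}{d\mu}$ for $i\ge1$. Suppose $\mathcal{D}((C_\phi)^2)$ is dense in $L^2(\mu)$ and let $k\ge1$ be fixed. Then: (i) $C_\phi$ is $k$-hyperexpansive if and only if $\triangle_{h,i}(x)\le0$ for $\mu$-a.e. $x$, for every $i=1,\dots,k$. (ii) $C_\phi$ is completely hyperexpansive if and only if, for $\mu$-almost every $x\in X$, the sequence $\{h_i(x)\}_{i=0}^\infty$ is completely alternating.
   Context: An operator $T$ in a Hilbert space $\mathcal{H}$ is a linear map $T:\mathcal{D}(T)\to\mathcal{H}$ on a linear subspace $\mathcal{D}(T)\subseteq\mathcal{H}$; powers $T^n$ have their natural domains. $C_\phi$ in $L^2(\mu)$ has domain $\{f\in L^2(\mu): f\circ\phi\in L^2(\mu)\}$ and acts by $C_\phi f=f\circ\phi$. The Radon-Nikodym derivatives $h_i$ take values in $[0,\infty]$. When $h_1,\dots,h_n$ are finite valued ($\mu$-a.e.), $\triangle_{h,n}(x)=\sum_{0\le i\le n}(-1)^i\binom{n}{i}h_i(x)$; a condition on $\triangle_{h,n}$ includes that it is defined. For an operator $T$ and $n\ge1$, $\Theta_{T,n}(f)=\sum_{0\le i\le n}(-1)^i\binom{n}{i}\|T^i f\|^2$ for $f\in\mathcal{D}(T^n)$. $T$ is $k$-hyperexpansive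 if $\Theta_{T,n}(f)\le0$ for all $f\in\mathcal{D}(T^n)$ and $n=1,\dots,k$; completely hyperexpansive if $\Theta_{T,n}(f)\le 0$ for all $f\in\mathcal{D}(T^n)$ and all $n\ge1$. A real sequence $\{\varphi(i)\}_{i=0}^\infty$ is completely alternating if $\sum_{0\le i\le n}(-1)^i\binom{n}{i}\varphi(m+i)\le0$ for all $m\ge0$ and $n\ge1$. *)

theory Defs
  imports "HOL-Analysis.Analysis"
begin

section \<open>The Hilbert space of square-integrable functions\<close>

text \<open>
  Vectors are classes of complex functions modulo equality almost everywhere, i.e. sets of
  functions \<open>'a \<Rightarrow> complex\<close>.  Functions that differ only outside \<open>space M\<close> are identified.
\<close>

definition L2_fun :: "'a measure \<Rightarrow> ('a \<Rightarrow> complex) set" where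
  "L2_fun M = {f \<in> borel_measurable M. integrable M (\<lambda>x. (norm (f x))\<^sup>2)}"

definition L2_rel :: "'a measure \<Rightarrow> (('a \<Rightarrow> complex) \<times> ('a \<Rightarrow> complex)) set" where
  "L2_rel M = {(f, g). f \<in> L2_fun M \<and> g \<in> L2_fun M \<and> (AE x in M. f x = g x)}"

definition L2 :: "'a measure \<Rightarrow> ('a \<Rightarrow> complex) set set" where
  "L2 M = L2_fun M // L2_rel M"

definition L2_class :: "'a measure \<Rightarrow> ('a \<Rightarrow> complex) \<Rightarrow> ('a \<Rightarrow> complex) set" where
  "L2_class M f = L2_rel M `` {f}"

definition L2_rep :: "('a \<Rightarrow> complex) set \<Rightarrow> 'a \<Rightarrow> complex" where
  "L2_rep F = (SOME f. f \<in> F)"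

definition L2_norm :: "'a measure \<Rightarrow> ('a \<Rightarrow> complex) set \<Rightarrow> real" where
  "L2_norm M F = sqrt (\<integral>x. (norm (L2_rep F x))\<^sup>2 \<partial>M)"

definition L2_dist :: "'a measure \<Rightarrow> ('a \<Rightarrow> complex) set \<Rightarrow> ('a \<Rightarrow> complex) set \<Rightarrow> real" where
  "L2_dist M F G = sqrt (\<integral>x. (norm (L2_rep F x - L2_rep G x))\<^sup>2 \<partial>M)"

definition L2_dense :: "'a measure \<Rightarrow> ('a \<Rightarrow> complex) set set \<Rightarrow> bool" where
  "L2_dense M D \<longleftrightarrow> D \<subseteq> L2 M \<and> (\<forall>F\<in>L2 M. \<forall>e>0. \<exists>G\<in>D. L2_dist M F G < e)"


section \<open>Operators and hyperexpansivity\<close>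

text \<open>
  A not necessarily everywhere defined operator \<open>T\<close> in a space with carrier \<open>H\<close> and norm \<open>N\<close> is
  a partial map; its domain is \<open>dom T\<close>.  Composition of partial maps
  yields the natural domains \<open>dom (T\<^sup>n\<^sup>+\<^sup>1) = {f \<in> dom (T\<^sup>n). T\<^sup>n f \<in> dom T}\<close>.
\<close>

primrec op_power :: "'h set \<Rightarrow> ('h \<rightharpoonup> 'h) \<Rightarrow> nat \<Rightarrow> ('h \<rightharpoonup> 'h)" where
  "op_power H T 0 = Some |` H"
| "op_power H T (Suc n) = T \<circ>\<^sub>m op_power H T n"

definition Theta :: "'h set \<Rightarrow> ('h \<Rightarrow> real) \<Rightarrow> ('h \<rightharpoonup> 'h) \<Rightarrow> nat \<Rightarrow> 'h \<Rightarrow> real" where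
  "Theta H N T n f =
    (\<Sum>i\<le>n. (-1) ^ i * real (n choose i) * (N (the (op_power H T i f)))\<^sup>2)"

definition k_hyperexpansive ::
    "'h set \<Rightarrow> ('h \<Rightarrow> real) \<Rightarrow> ('h \<rightharpoonup> 'h) \<Rightarrow> nat \<Rightarrow> bool" where
  "k_hyperexpansive H N T k \<longleftrightarrow>
    (\<forall>n\<in>{1..k}. \<forall>f\<in>dom (op_power H T n). Theta H N T n f \<le> 0)"

definition completely_hyperexpansive ::
    "'h set \<Rightarrow> ('h \<Rightarrow> real) \<Rightarrow> ('h \<rightharpoonup> 'h) \<Rightarrow> bool" where
  "completely_hyperexpansive H N T \<longleftrightarrow>
    (\<forall>n\<ge>1. \<forall>f\<in>dom (op_power H T n). Theta H N T n f \<le> 0)"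

definition completely_alternating :: "(nat \<Rightarrow> real) \<Rightarrow> bool" where
  "completely_alternating a \<longleftrightarrow>
    (\<forall>m. \<forall>n\<ge>1. (\<Sum>i\<le>n. (-1) ^ i * real (n choose i) * a (m + i)) \<le> 0)"


section \<open>Composition operators\<close>

text \<open>
  The choice of representative in \<open>comp_op\<close> is irrelevant when the image measure of \<open>M\<close> under
  \<open>\<phi>\<close> is absolutely continuous with respect to \<open>M\<close>; see \<open>comp_op_class\<close> below.
\<close>

definition comp_op ::
    "'a measure \<Rightarrow> ('a \<Rightarrow> 'a) \<Rightarrow> ('a \<Rightarrow> complex) set \<rightharpoonup> ('a \<Rightarrow> complex) set" where
  "comp_op M \<phi> F =
    (if F \<in> L2 M \<and> L2_rep F \<circ> \<phi> \<in> L2_fun M then Some (L2_class M (L2_rep F \<circ> \<phi>)) else None)"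

definition h_deriv :: "'a measure \<Rightarrow> ('a \<Rightarrow> 'a) \<Rightarrow> nat \<Rightarrow> 'a \<Rightarrow> ennreal" where
  "h_deriv M \<phi> i = (if i = 0 then (\<lambda>_. 1) else RN_deriv M (distr M M (\<phi> ^^ i)))"

text \<open>
  \<open>enn2real\<close> sends \<open>\<infinity>\<close> to \<open>0\<close>, so \<open>Delta_h M \<phi> n\<close> has its intended meaning only where
  \<open>Delta_h_defined M \<phi> n\<close> holds.
\<close>

definition Delta_h_defined :: "'a measure \<Rightarrow> ('a \<Rightarrow> 'a) \<Rightarrow> nat \<Rightarrow> bool" where
  "Delta_h_defined M \<phi> n \<longleftrightarrow> (\<forall>i\<in>{1..n}. AE x in M. h_deriv M \<phi> i x < \<infinity>)"

definition Delta_h :: "'a measure \<Rightarrow> ('a \<Rightarrow> 'a) \<Rightarrow> nat \<Rightarrow> 'a \<Rightarrow> real" where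
  "Delta_h M \<phi> n x = (\<Sum>i\<le>n. (-1) ^ i * real (n choose i) * enn2real (h_deriv M \<phi> i x))"


section \<open>Independence of representatives\<close>

lemma equiv_L2_rel: "equiv (L2_fun M) (L2_rel M)"
proof (rule equivI)
  show "L2_rel M \<subseteq> L2_fun M \<times> L2_fun M" by (auto simp: L2_rel_def)
  show "refl_on (L2_fun M) (L2_rel M)" by (auto simp: refl_on_def L2_rel_def)
  show "sym (L2_rel M)" by (auto simp: sym_def L2_rel_def)
  show "trans (L2_rel M)" unfolding trans_def L2_rel_def by auto
qed

lemma L2_rep_class:
  assumes "f \<in> L2_fun M"
  shows "(f, L2_rep (L2_class M f)) \<in> L2_rel M"
proof -
  have "f \<in> L2_class M f"
    using assms by (auto simp: L2_class_def L2_rel_def)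
  then have "L2_rep (L2_class M f) \<in> L2_class M f"
    unfolding L2_rep_def by (rule someI[of "\<lambda>g. g \<in> L2_class M f"])
  then show ?thesis by (simp add: L2_class_def)
qed

lemma L2_class_in: "f \<in> L2_fun M \<Longrightarrow> L2_class M f \<in> L2 M"
  by (simp add: L2_class_def L2_def quotientI)

lemma L2_norm_class:
  assumes "f \<in> L2_fun M"
  shows "L2_norm M (L2_class M f) = sqrt (\<integral>x. (norm (f x))\<^sup>2 \<partial>M)"
proof -
  let ?g = "L2_rep (L2_class M f)"
  have m: "f \<in> borel_measurable M" "?g \<in> borel_measurable M" and "AE x in M. f x = ?g x"
    using L2_rep_class[OF assms] by (auto simp: L2_rel_def L2_fun_def)
  then have "(\<integral>x. (norm (?g x))\<^sup>2 \<partial>M) = (\<integral>x. (norm (f x))\<^sup>2 \<partial>M)"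
    by (intro integral_cong_AE) auto
  then show ?thesis by (simp add: L2_norm_def)
qed

lemma L2_dist_class:
  assumes "f \<in> L2_fun M" "g \<in> L2_fun M"
  shows "L2_dist M (L2_class M f) (L2_class M g) = sqrt (\<integral>x. (norm (f x - g x))\<^sup>2 \<partial>M)"
proof -
  let ?f = "L2_rep (L2_class M f)" and ?g = "L2_rep (L2_class M g)"
  have m: "f \<in> borel_measurable M" "?f \<in> borel_measurable M"
      "g \<in> borel_measurable M" "?g \<in> borel_measurable M"
    and ae: "AE x in M. f x = ?f x" "AE x in M. g x = ?g x"
    using L2_rep_class[OF assms(1)] L2_rep_class[OF assms(2)]
    by (auto simp: L2_rel_def L2_fun_def)
  have "AE x in M. (norm (?f x - ?g x))\<^sup>2 = (norm (f x - g x))\<^sup>2"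
    using ae by eventually_elim simp
  then have "(\<integral>x. (norm (?f x - ?g x))\<^sup>2 \<partial>M) = (\<integral>x. (norm (f x - g x))\<^sup>2 \<partial>M)"
    using m by (intro integral_cong_AE) auto
  then show ?thesis by (simp add: L2_dist_def)
qed

lemma AE_comp_nonsingular:
  assumes "\<phi> \<in> M \<rightarrow>\<^sub>M M" "absolutely_continuous M (distr M M \<phi>)" "AE x in M. P x"
  shows "AE x in M. P (\<phi> x)"
proof -
  have "AE y in distr M M \<phi>. P y"
    using absolutely_continuous_AE[of "distr M M \<phi>" M P] assms by simp
  then show ?thesis using AE_distrD assms(1) by blast
qed

lemma comp_op_class:
  assumes \<phi>: "\<phi> \<in> M \<rightarrow>\<^sub>M M" "absolutely_continuous M (distr M M \<phi>)"
    and f: "f \<in> L2_fun M"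
  shows "comp_op M \<phi> (L2_class M f) =
    (if f \<circ> \<phi> \<in> L2_fun M then Some (L2_class M (f \<circ> \<phi>)) else None)"
proof -
  let ?g = "L2_rep (L2_class M f)"
  have g: "?g \<in> L2_fun M" and "AE x in M. f x = ?g x"
    using L2_rep_class[OF f] by (auto simp: L2_rel_def)
  then have ae: "AE x in M. f (\<phi> x) = ?g (\<phi> x)"
    using AE_comp_nonsingular[OF \<phi>] by blast
  have mf: "f \<circ> \<phi> \<in> borel_measurable M" and mg: "?g \<circ> \<phi> \<in> borel_measurable M"
    using f g \<phi>(1) by (auto simp: L2_fun_def intro: measurable_comp)
  have "integrable M (\<lambda>x. (norm ((f \<circ> \<phi>) x))\<^sup>2) \<longleftrightarrow> integrable M (\<lambda>x. (norm ((?g \<circ> \<phi>) x))\<^sup>2)"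
  proof (rule integrable_cong_AE)
    show "(\<lambda>x. (norm ((f \<circ> \<phi>) x))\<^sup>2) \<in> borel_measurable M" using mf by measurable
    show "(\<lambda>x. (norm ((?g \<circ> \<phi>) x))\<^sup>2) \<in> borel_measurable M" using mg by measurable
    show "AE x in M. (norm ((f \<circ> \<phi>) x))\<^sup>2 = (norm ((?g \<circ> \<phi>) x))\<^sup>2" using ae by eventually_elim simp
  qed
  then have iff: "f \<circ> \<phi> \<in> L2_fun M \<longleftrightarrow> ?g \<circ> \<phi> \<in> L2_fun M"
    using mf mg by (simp add: L2_fun_def)
  have "L2_class M (f \<circ> \<phi>) = L2_class M (?g \<circ> \<phi>)" if "f \<circ> \<phi> \<in> L2_fun M"
  proof -
    have "(f \<circ> \<phi>, ?g \<circ> \<phi>) \<in> L2_rel M"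
      using that iff ae by (simp add: L2_rel_def)
    from equiv_class_eq[OF equiv_L2_rel this] show ?thesis
      by (simp only: L2_class_def)
  qed
  then show ?thesis
    using iff L2_class_in[OF f] by (auto simp: comp_op_def)
qed

end

theory Submission
  imports Defs
begin

text \<open>
  The image measure of \<open>M\<close> under \<open>\<phi>\<^sup>i\<close> has density \<open>h\<^sub>i\<close>, so \<open>\<Theta>\<^sub>n(f)\<close> is the integral of
  \<open>\<triangle>\<^sub>h\<^sub>,\<^sub>n \<bar>f\<bar>\<^sup>2\<close>, and the sign of \<open>\<triangle>\<^sub>h\<^sub>,\<^sub>n\<close> is read off by testing on indicators of sets on
  which all \<open>h\<^sub>i\<close> involved are integrable.  Testing on \<open>f \<circ> \<phi>\<^sup>m\<close> instead of \<open>f\<close> gives the shifted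
  inequalities.  Density of the domain of the square only makes \<open>h\<^sub>1\<close> and \<open>h\<^sub>2\<close> finite; for the
  higher \<open>h\<^sub>i\<close> one uses \<open>1 - 2 h\<^sub>1 + h\<^sub>2 \<le> 0\<close>: the bound \<open>h\<^sub>2 \<le> 2 h\<^sub>1\<close> says that the
  integral of \<open>g \<circ> \<phi>\<^sup>2\<close> is at most twice that of \<open>g \<circ> \<phi>\<close> for all \<open>g \<ge> 0\<close>, and replacing \<open>g\<close>
  by \<open>g \<circ> \<phi>\<^sup>i\<close> carries finiteness from \<open>h\<^sub>i\<^sub>+\<^sub>1\<close> to \<open>h\<^sub>i\<^sub>+\<^sub>2\<close>.
\<close>

section \<open>Square-integrable functions and their classes\<close>

lemma L2E:
  assumes "F \<in> L2 M"
  obtains f where "f \<in> L2_fun M" "F = L2_class M f"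
  using assms by (auto simp: L2_def L2_class_def elim!: quotientE)

lemma L2_fun_iff_nn_integral:
  assumes "f \<in> borel_measurable M"
  shows "f \<in> L2_fun M \<longleftrightarrow> (\<integral>\<^sup>+x. ennreal ((norm (f x))\<^sup>2) \<partial>M) < \<infinity>"
  using assms by (auto simp: L2_fun_def integrable_iff_bounded)

section \<open>Iterates of the map and change of variables\<close>

locale nonsingular_map = sigma_finite_measure M
  for M :: "'a measure" +
  fixes \<phi> :: "'a \<Rightarrow> 'a"
  assumes map_measurable: "\<phi> \<in> M \<rightarrow>\<^sub>M M"
    and map_nonsingular: "absolutely_continuous M (distr M M \<phi>)"
begin

abbreviation h :: "nat \<Rightarrow> 'a \<Rightarrow> ennreal" where
  "h \<equiv> h_deriv M \<phi>"

abbreviation hr :: "nat \<Rightarrow> 'a \<Rightarrow> real" where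
  "hr i x \<equiv> enn2real (h i x)"

abbreviation C_power :: "nat \<Rightarrow> (('a \<Rightarrow> complex) set \<rightharpoonup> ('a \<Rightarrow> complex) set)" where
  "C_power \<equiv> op_power (L2 M) (comp_op M \<phi>)"

lemma measurable_funpow [measurable]: "\<phi> ^^ i \<in> M \<rightarrow>\<^sub>M M"
proof (induction i)
  case 0
  show ?case by (simp add: id_def)
next
  case (Suc i)
  then show ?case using measurable_comp[OF Suc map_measurable] by (simp only: funpow.simps)
qed

lemma AE_funpow:
  assumes "AE x in M. P x"
  shows "AE x in M. P ((\<phi> ^^ i) x)"
proof (induction i)
  case 0
  show ?case using assms by simp
next
  case (Suc i)
  from AE_comp_nonsingular[OF map_measurable map_nonsingular Suc]
  show ?case by (simp add: funpow_swap1)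
qed

text \<open>The complement of a null set has full measure, and \<open>AE_funpow\<close> pulls full
  measure back along the iterate. This is what makes the \<open>RN_deriv\<close> in
  \<open>h_deriv\<close> a genuine density.\<close>

lemma nonsingular_funpow: "absolutely_continuous M (distr M M (\<phi> ^^ i))"
  unfolding absolutely_continuous_def
proof
  fix N assume N: "N \<in> null_sets M"
  then have "AE x in M. x \<notin> N" by (rule AE_not_in)
  from AE_funpow[OF this, of i] have "AE x in M. (\<phi> ^^ i) x \<notin> N" .
  then have "AE y in distr M M (\<phi> ^^ i). y \<notin> N"
    using N by (subst AE_distr_iff) (auto intro!: sets.sets_Collect_neg)
  then show "N \<in> null_sets (distr M M (\<phi> ^^ i))"
    using N by (subst (asm) AE_iff_null_sets[symmetric]) auto
qed

lemma h_measurable [measurable]: "h i \<in> borel_measurable M"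
  by (simp add: h_deriv_def)

text \<open>Change of variables for the image measure, valid in \<open>ennreal\<close> even where
  \<open>h i\<close> is infinite. The case \<open>i = 0\<close> is separate because
  \<open>h 0\<close> is set to 1 instead of being a chosen derivative.\<close>

lemma nn_integral_funpow:
  assumes [measurable]: "g \<in> borel_measurable M"
  shows "(\<integral>\<^sup>+x. g ((\<phi> ^^ i) x) \<partial>M) = (\<integral>\<^sup>+x. h i x * g x \<partial>M)"
proof (cases "i = 0")
  case True
  then show ?thesis by (simp add: h_deriv_def)
next
  case False
  have "(\<integral>\<^sup>+x. g ((\<phi> ^^ i) x) \<partial>M) = (\<integral>\<^sup>+x. g x \<partial>distr M M (\<phi> ^^ i))"
    by (simp add: nn_integral_distr)
  also have "distr M M (\<phi> ^^ i) = density M (RN_deriv M (distr M M (\<phi> ^^ i)))"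
    using density_RN_deriv[OF nonsingular_funpow] by simp
  also have "(\<integral>\<^sup>+x. g x \<partial>\<dots>) = (\<integral>\<^sup>+x. h i x * g x \<partial>M)"
    using False by (simp add: nn_integral_density h_deriv_def)
  finally show ?thesis .
qed

lemma comp_funpow_measurable:
  "f \<in> borel_measurable M \<Longrightarrow> f \<circ> \<phi> ^^ i \<in> borel_measurable M"
  using measurable_comp[OF measurable_funpow] by blast

lemma comp_funpow_in_L2_iff:
  fixes f :: "'a \<Rightarrow> complex"
  assumes [measurable]: "f \<in> borel_measurable M"
  shows "f \<circ> \<phi> ^^ i \<in> L2_fun M \<longleftrightarrow> (\<integral>\<^sup>+x. h i x * ennreal ((norm (f x))\<^sup>2) \<partial>M) < \<infinity>"
  using nn_integral_funpow[of "\<lambda>x. ennreal ((norm (f x))\<^sup>2)" i]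
  by (simp add: L2_fun_iff_nn_integral comp_funpow_measurable)

text \<open>Finiteness of \<open>h i\<close> enters because \<open>enn2real\<close> sends infinity
  to 0: only where \<open>h i\<close> is finite does \<open>hr i\<close> represent the same
  density.\<close>

lemma integral_funpow:
  fixes f :: "'a \<Rightarrow> complex"
  assumes [measurable]: "f \<in> borel_measurable M"
    and "f \<circ> \<phi> ^^ i \<in> L2_fun M" and fin: "AE x in M. h i x < \<infinity>"
  shows "integrable M (\<lambda>x. hr i x * (norm (f x))\<^sup>2)" (is "integrable M ?g")
    and "(\<integral>x. (norm (f ((\<phi> ^^ i) x)))\<^sup>2 \<partial>M) = (\<integral>x. hr i x * (norm (f x))\<^sup>2 \<partial>M)"
proof -
  have "(\<integral>\<^sup>+x. ennreal (?g x) \<partial>M) = (\<integral>\<^sup>+x. h i x * ennreal ((norm (f x))\<^sup>2) \<partial>M)"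
    by (rule nn_integral_cong_AE) (use fin in eventually_elim, simp add: ennreal_mult)
  moreover have "(\<integral>\<^sup>+x. h i x * ennreal ((norm (f x))\<^sup>2) \<partial>M) < \<infinity>"
    using assms(1,2) comp_funpow_in_L2_iff by blast
  moreover have "(\<integral>\<^sup>+x. h i x * ennreal ((norm (f x))\<^sup>2) \<partial>M) =
      (\<integral>\<^sup>+x. ennreal ((norm (f ((\<phi> ^^ i) x)))\<^sup>2) \<partial>M)"
    by (rule nn_integral_funpow[symmetric]) measurable
  ultimately show "integrable M ?g"
    and "(\<integral>x. (norm (f ((\<phi> ^^ i) x)))\<^sup>2 \<partial>M) = (\<integral>x. ?g x \<partial>M)"
    by (auto simp: integrable_iff_bounded integral_eq_nn_integral)
qed

section \<open>Powers of the composition operator\<close>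

text \<open>The natural domain asks every intermediate composite to be square-integrable, hence the
  condition on all \<open>i \<le> n\<close>; membership of the last composite alone would be
  weaker.\<close>

lemma op_power_class:
  assumes f: "f \<in> L2_fun M"
  shows "C_power n (L2_class M f) =
    (if \<forall>i\<le>n. f \<circ> \<phi> ^^ i \<in> L2_fun M then Some (L2_class M (f \<circ> \<phi> ^^ n)) else None)"
proof (induction n)
  case 0
  show ?case using f L2_class_in[OF f] by simp
next
  case (Suc n)
  have "(f \<circ> \<phi> ^^ n) \<circ> \<phi> = f \<circ> \<phi> ^^ Suc n"
    by (simp only: comp_assoc funpow_Suc_right)
  then show ?case
    using Suc comp_op_class[OF map_measurable map_nonsingular, of "f \<circ> \<phi> ^^ n"]
    by (auto simp: map_comp_def le_Suc_eq simp del: funpow.simps comp_apply)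
qed

lemma dom_C_powerE:
  assumes "F \<in> dom (C_power n)"
  obtains f where "F = L2_class M f" "\<And>i. i \<le> n \<Longrightarrow> f \<circ> \<phi> ^^ i \<in> L2_fun M"
proof -
  \<comment> \<open>Domains of powers decrease in \<open>n\<close>, and power zero is restricted to
    \<open>L2 M\<close>.\<close>
  have "F \<in> L2 M"
    using assms
    by (induction n) (auto simp: restrict_map_def map_comp_def dom_def split: if_splits option.splits)
  then obtain f where f: "f \<in> L2_fun M" "F = L2_class M f" by (rule L2E)
  then have "\<forall>i\<le>n. f \<circ> \<phi> ^^ i \<in> L2_fun M"
    using assms op_power_class[OF f(1), of n] by (auto split: if_splits)
  then show ?thesis using that f(2) by blast
qed

lemma dom_C_powerI:
  assumes "\<And>i. i \<le> n \<Longrightarrow> f \<circ> \<phi> ^^ i \<in> L2_fun M"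
  shows "L2_class M f \<in> dom (C_power n)"
  using assms assms[of 0] by (auto simp: op_power_class)

section \<open>Theta as an integral against the derivatives\<close>

lemma Theta_class:
  assumes L: "\<And>i. i \<le> n \<Longrightarrow> f \<circ> \<phi> ^^ i \<in> L2_fun M"
  shows "Theta (L2 M) (L2_norm M) (comp_op M \<phi>) n (L2_class M f) =
    (\<Sum>i\<le>n. (-1) ^ i * real (n choose i) * (\<integral>x. (norm (f ((\<phi> ^^ i) x)))\<^sup>2 \<partial>M))"
  unfolding Theta_def
proof (rule sum.cong[OF refl])
  fix i assume "i \<in> {..n}"
  then have i: "\<And>j. j \<le> i \<Longrightarrow> f \<circ> \<phi> ^^ j \<in> L2_fun M" using L by simp
  then have "the (C_power i (L2_class M f)) = L2_class M (f \<circ> \<phi> ^^ i)"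
    using i[of 0] by (simp add: op_power_class)
  then show "(-1) ^ i * real (n choose i) * (L2_norm M (the (C_power i (L2_class M f))))\<^sup>2 =
      (-1) ^ i * real (n choose i) * (\<integral>x. (norm (f ((\<phi> ^^ i) x)))\<^sup>2 \<partial>M)"
    using i[of i] by (simp add: L2_norm_class)
qed

text \<open>Composing the test function with \<open>\<phi> ^^ m\<close> turns its
  \<open>i\<close>-th iterate into \<open>f \<circ> \<phi> ^^ (m + i)\<close>, so each
  \<open>h i\<close> is replaced by \<open>h (m + i)\<close>. Each of the \<open>n + 1\<close>
  integrals is finite, so the signed sum may be moved inside.\<close>

lemma Theta_comp_funpow_class:
  assumes f: "\<And>i. i \<le> m + n \<Longrightarrow> f \<circ> \<phi> ^^ i \<in> L2_fun M"
    and fin: "\<And>i. i \<le> m + n \<Longrightarrow> AE x in M. h i x < \<infinity>"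
  shows "L2_class M (f \<circ> \<phi> ^^ m) \<in> dom (C_power n)"
    and "integrable M
      (\<lambda>x. (\<Sum>i\<le>n. (-1) ^ i * real (n choose i) * hr (m + i) x) * (norm (f x))\<^sup>2)"
    and "Theta (L2 M) (L2_norm M) (comp_op M \<phi>) n (L2_class M (f \<circ> \<phi> ^^ m)) =
      (\<integral>x. (\<Sum>i\<le>n. (-1) ^ i * real (n choose i) * hr (m + i) x) * (norm (f x))\<^sup>2 \<partial>M)"
proof -
  have meas: "f \<in> borel_measurable M" using f[of 0] by (simp add: L2_fun_def)
  have comp: "(f \<circ> \<phi> ^^ m) \<circ> \<phi> ^^ i = f \<circ> \<phi> ^^ (m + i)" for i
    by (simp add: comp_assoc funpow_add)
  have L: "(f \<circ> \<phi> ^^ m) \<circ> \<phi> ^^ i \<in> L2_fun M" if "i \<le> n" for i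
    unfolding comp using f that by simp
  show "L2_class M (f \<circ> \<phi> ^^ m) \<in> dom (C_power n)"
    by (rule dom_C_powerI[OF L])
  have int: "integrable M (\<lambda>x. hr (m + i) x * (norm (f x))\<^sup>2)"
      "(\<integral>x. (norm (f ((\<phi> ^^ (m + i)) x)))\<^sup>2 \<partial>M) = (\<integral>x. hr (m + i) x * (norm (f x))\<^sup>2 \<partial>M)"
    if "i \<le> n" for i
    using integral_funpow[OF meas f fin, of "m + i"] that by auto
  have eq: "(\<lambda>x. (\<Sum>i\<le>n. (-1) ^ i * real (n choose i) * hr (m + i) x) * (norm (f x))\<^sup>2) =
      (\<lambda>x. \<Sum>i\<le>n. (-1) ^ i * real (n choose i) * (hr (m + i) x * (norm (f x))\<^sup>2))"
    by (simp add: sum_distrib_right mult.assoc)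
  show "integrable M
      (\<lambda>x. (\<Sum>i\<le>n. (-1) ^ i * real (n choose i) * hr (m + i) x) * (norm (f x))\<^sup>2)"
    unfolding eq using int(1) by (intro Bochner_Integration.integrable_sum) auto
  have "(\<integral>x. (norm ((f \<circ> \<phi> ^^ m) ((\<phi> ^^ i) x)))\<^sup>2 \<partial>M) = (\<integral>x. hr (m + i) x * (norm (f x))\<^sup>2 \<partial>M)"
    if "i \<le> n" for i
    using int(2)[OF that] by (simp add: funpow_add)
  then have "Theta (L2 M) (L2_norm M) (comp_op M \<phi>) n (L2_class M (f \<circ> \<phi> ^^ m)) =
      (\<Sum>i\<le>n. (-1) ^ i * real (n choose i) * (\<integral>x. hr (m + i) x * (norm (f x))\<^sup>2 \<partial>M))"
    by (subst Theta_class[OF L]) auto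
  also have "\<dots> = (\<integral>x. (\<Sum>i\<le>n. (-1) ^ i * real (n choose i) * hr (m + i) x) * (norm (f x))\<^sup>2 \<partial>M)"
    unfolding eq using int(1) by (subst Bochner_Integration.integral_sum) auto
  finally show "Theta (L2 M) (L2_norm M) (comp_op M \<phi>) n (L2_class M (f \<circ> \<phi> ^^ m)) = \<dots>" .
qed

lemma Theta_nonpos:
  assumes F: "F \<in> dom (C_power n)"
    and "Delta_h_defined M \<phi> n" "AE x in M. Delta_h M \<phi> n x \<le> 0"
  shows "Theta (L2 M) (L2_norm M) (comp_op M \<phi>) n F \<le> 0"
proof -
  obtain f where f: "F = L2_class M f" "\<And>i. i \<le> n \<Longrightarrow> f \<circ> \<phi> ^^ i \<in> L2_fun M"
    using dom_C_powerE[OF F] by metis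
  \<comment> \<open>\<open>Delta_h_defined\<close> starts at index 1; index 0 is the constant
    1.\<close>
  have fin: "AE x in M. h i x < \<infinity>" if "i \<le> n" for i
    using assms(2) that by (cases "i = 0") (auto simp: Delta_h_defined_def h_deriv_def)
  have "Theta (L2 M) (L2_norm M) (comp_op M \<phi>) n F =
      (\<integral>x. Delta_h M \<phi> n x * (norm (f x))\<^sup>2 \<partial>M)"
    using Theta_comp_funpow_class(3)[of 0 n f] f fin by (simp add: Delta_h_def)
  also have "\<dots> \<le> 0"
  proof -
    have "AE x in M. 0 \<le> - (Delta_h M \<phi> n x * (norm (f x))\<^sup>2)"
      using assms(3) by eventually_elim (simp add: mult_nonpos_nonneg)
    then have "0 \<le> (\<integral>x. - (Delta_h M \<phi> n x * (norm (f x))\<^sup>2) \<partial>M)"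
      by (rule integral_nonneg_AE)
    then show ?thesis by simp
  qed
  finally show ?thesis .
qed

section \<open>Localisation and the sign of the alternating sums\<close>

text \<open>A set of finite measure is cut down to the points where \<open>h 0, ..., h n\<close> are
  all at most \<open>j\<close>; finiteness almost everywhere makes these sets cover almost
  everything.\<close>

lemma exhaustion:
  assumes "\<And>i. i \<le> n \<Longrightarrow> AE x in M. h i x < \<infinity>"
  obtains A :: "nat \<Rightarrow> 'a set" where "\<And>j. A j \<in> sets M" "AE x in M. \<exists>j. x \<in> A j"
    "\<And>i j. i \<le> n \<Longrightarrow> (\<integral>\<^sup>+x. h i x * indicator (A j) x \<partial>M) < \<infinity>"
proof -
  obtain F :: "nat \<Rightarrow> 'a set" where F: "range F \<subseteq> sets M" "(\<Union>j. F j) = space M"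
      "\<And>j. emeasure M (F j) \<noteq> \<infinity>" "incseq F"
    by (rule sigma_finite_incseq) blast
  have [measurable]: "F j \<in> sets M" for j using F(1) by blast
  define A where "A j = {x \<in> space M. x \<in> F j \<and> (\<forall>i\<in>{..n}. h i x \<le> of_nat j)}" for j
  have [measurable]: "A j \<in> sets M" for j
    unfolding A_def by measurable
  have "AE x in M. \<exists>j. x \<in> A j"
  proof -
    have "AE x in M. \<forall>i\<in>{..n}. h i x < \<infinity>"
      using assms by (intro AE_finite_allI) auto
    then show ?thesis using AE_space
    proof eventually_elim
      case (elim x)
      have "\<exists>b. h i x \<le> of_nat b" if "i \<le> n" for i
        using ennreal_Ex_less_of_nat[of "h i x"] elim that by (force intro: less_imp_le)
      then obtain b where b: "\<And>i. i \<le> n \<Longrightarrow> h i x \<le> of_nat (b i)" by metis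
      obtain j0 where j0: "x \<in> F j0" using elim F(2) by blast
      \<comment> \<open>One index that dominates \<open>j0\<close> and every bound
        \<open>b i\<close>; monotonicity of \<open>F\<close> then keeps \<open>x\<close> in
        \<open>F j\<close>.\<close>
      define j where "j = j0 + (\<Sum>i\<le>n. b i)"
      have "h i x \<le> of_nat j" if "i \<le> n" for i
      proof -
        have "b i \<le> (\<Sum>i\<le>n. b i)" using that by (intro member_le_sum) auto
        then have "b i \<le> j" by (simp add: j_def)
        then show ?thesis using b[OF that] by (meson of_nat_mono order_trans)
      qed
      moreover have "x \<in> F j"
        using j0 monoD[OF F(4), of j0 j] by (auto simp: j_def)
      ultimately show ?case using elim by (auto simp: A_def)
    qed
  qed
  moreover have "(\<integral>\<^sup>+x. h i x * indicator (A j) x \<partial>M) < \<infinity>" if "i \<le> n" for i j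
  proof -
    have "(\<integral>\<^sup>+x. h i x * indicator (A j) x \<partial>M) \<le> (\<integral>\<^sup>+x. of_nat j * indicator (F j) x \<partial>M)"
      using that by (intro nn_integral_mono) (auto simp: A_def split: split_indicator)
    also have "\<dots> = of_nat j * emeasure M (F j)"
      by (simp add: nn_integral_cmult)
    also have "\<dots> < \<infinity>"
      using F(3)[of j] by (simp add: ennreal_mult_less_top less_top of_nat_less_top)
    finally show ?thesis .
  qed
  ultimately show ?thesis using that[of A] by simp
qed

text \<open>If the sum \<open>w\<close> were positive on a non-null part of some \<open>A j\<close>,
  the indicator of that part would make the integral for Theta strictly positive.\<close>

lemma alternating_sum_nonpos:
  assumes fin: "\<And>i. i \<le> m + n \<Longrightarrow> AE x in M. h i x < \<infinity>"
    and Theta: "\<And>F. F \<in> dom (C_power n) \<Longrightarrow> Theta (L2 M) (L2_norm M) (comp_op M \<phi>) n F \<le> 0"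
  shows "AE x in M. (\<Sum>i\<le>n. (-1) ^ i * real (n choose i) * hr (m + i) x) \<le> 0"
proof -
  define w where "w x = (\<Sum>i\<le>n. (-1) ^ i * real (n choose i) * hr (m + i) x)" for x
  have [measurable]: "w \<in> borel_measurable M" unfolding w_def by measurable
  obtain A :: "nat \<Rightarrow> 'a set" where A: "\<And>j. A j \<in> sets M" "AE x in M. \<exists>j. x \<in> A j"
    "\<And>i j. i \<le> m + n \<Longrightarrow> (\<integral>\<^sup>+x. h i x * indicator (A j) x \<partial>M) < \<infinity>"
    using exhaustion[of "m + n", OF fin] by blast
  have "AE x in M. x \<in> A j \<longrightarrow> w x \<le> 0" for j
  proof -
    have [measurable]: "A j \<in> sets M" by (rule A(1))
    define B where "B = {x \<in> space M. x \<in> A j \<and> w x > 0}"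
    have [measurable]: "B \<in> sets M" unfolding B_def by measurable
    \<comment> \<open>Since \<open>B\<close> lies in \<open>A j\<close>, all composites up to
      \<open>m + n\<close> are square-integrable, so \<open>f \<circ> \<phi> ^^ m\<close> is an
      admissible test.\<close>
    define f :: "'a \<Rightarrow> complex" where "f = indicator B"
    have [measurable]: "f \<in> borel_measurable M" unfolding f_def by measurable
    have norm_f: "(norm (f x))\<^sup>2 = indicator B x" for x
      by (simp add: f_def split: split_indicator)
    have f: "f \<circ> \<phi> ^^ i \<in> L2_fun M" if "i \<le> m + n" for i
    proof -
      have "(\<integral>\<^sup>+x. h i x * ennreal ((norm (f x))\<^sup>2) \<partial>M) \<le> (\<integral>\<^sup>+x. h i x * indicator (A j) x \<partial>M)"
        unfolding norm_f by (intro nn_integral_mono) (auto simp: B_def split: split_indicator)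
      also have "\<dots> < \<infinity>" using A(3) that by blast
      finally show ?thesis by (simp add: comp_funpow_in_L2_iff)
    qed
    have int: "integrable M (\<lambda>x. w x * indicator B x)"
      and le: "(\<integral>x. w x * indicator B x \<partial>M) \<le> 0"
      using Theta_comp_funpow_class[of m n f, OF f fin] Theta[of "L2_class M (f \<circ> \<phi> ^^ m)"]
      unfolding norm_f w_def by auto
    have nonneg: "0 \<le> w x * indicator B x" for x
      by (auto simp: B_def split: split_indicator)
    \<comment> \<open>The integrand is nonnegative with nonpositive integral, so it vanishes almost
      everywhere; as \<open>w > 0\<close> on \<open>B\<close>, this makes \<open>B\<close>
      null.\<close>
    then have "(\<integral>x. w x * indicator B x \<partial>M) = 0"
      using le by (intro antisym integral_nonneg_AE) auto
    then have "AE x in M. w x * indicator B x = 0"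
      using integral_nonneg_eq_0_iff_AE[OF int] nonneg by simp
    then show ?thesis using AE_space
      by eventually_elim (auto simp: B_def split: split_indicator_asm)
  qed
  then have "AE x in M. \<forall>j. x \<in> A j \<longrightarrow> w x \<le> 0" by (subst AE_all_countable) blast
  with A(2) have "AE x in M. w x \<le> 0" by eventually_elim blast
  then show ?thesis unfolding w_def .
qed

section \<open>Finiteness of the derivatives\<close>

text \<open>Every function in the domain vanishes almost everywhere on the set where
  \<open>h i\<close> is infinite. If that set were not null, the indicator of a piece
  \<open>A\<close> of finite positive measure would stay at distance at least
  \<open>sqrt (measure M A)\<close> from the domain.\<close>

lemma dense_dom_C_power_imp_h_finite:
  assumes dense: "L2_dense M (dom (C_power n))" and i: "i \<le> n"
  shows "AE x in M. h i x < \<infinity>"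
proof -
  obtain F :: "nat \<Rightarrow> 'a set" where F: "range F \<subseteq> sets M" "(\<Union>j. F j) = space M"
      "\<And>j. emeasure M (F j) \<noteq> \<infinity>"
    by (rule sigma_finite) blast
  have [measurable]: "F j \<in> sets M" for j using F(1) by blast
  have "AE x in M. x \<in> F j \<longrightarrow> h i x < \<infinity>" for j
  proof (rule ccontr)
    define A where "A = {x \<in> space M. x \<in> F j \<and> h i x = \<infinity>}"
    have [measurable]: "A \<in> sets M" unfolding A_def by measurable
    have "emeasure M A \<le> emeasure M (F j)" by (intro emeasure_mono) (auto simp: A_def)
    then have A_fin: "emeasure M A < \<infinity>" using F(3)[of j] by (simp add: less_top top_unique)
    assume contr: "\<not> (AE x in M. x \<in> F j \<longrightarrow> h i x < \<infinity>)"
    have "measure M A > 0"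
    proof (rule ccontr)
      assume "\<not> measure M A > 0"
      then have "A \<in> null_sets M"
        using A_fin measure_nonneg[of M A]
        by (auto simp: null_sets_def less_top emeasure_eq_ennreal_measure)
      then have "AE x in M. x \<notin> A" by (rule AE_not_in)
      then have "AE x in M. x \<in> F j \<longrightarrow> h i x < \<infinity>"
        using AE_space by eventually_elim (auto simp: A_def less_top)
      with contr show False ..
    qed
    define f :: "'a \<Rightarrow> complex" where "f = indicator A"
    have norm_f: "(norm (f x))\<^sup>2 = indicator A x" for x
      by (simp add: f_def split: split_indicator)
    have f: "f \<in> L2_fun M"
      using A_fin unfolding L2_fun_def by (simp add: norm_f) (simp add: f_def)
    obtain G where G: "G \<in> dom (C_power n)" "L2_dist M (L2_class M f) G < sqrt (measure M A)"
      using dense L2_class_in[OF f] \<open>measure M A > 0\<close>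
      unfolding L2_dense_def by (metis real_sqrt_gt_0_iff)
    obtain g where g: "G = L2_class M g" "\<And>i. i \<le> n \<Longrightarrow> g \<circ> \<phi> ^^ i \<in> L2_fun M"
      using dom_C_powerE[OF G(1)] by metis
    have g_L2: "g \<in> L2_fun M" using g(2)[of 0] by simp
    have [measurable]: "f \<in> borel_measurable M" "g \<in> borel_measurable M"
      using f g_L2 by (auto simp: L2_fun_def)
    have "(\<integral>\<^sup>+x. h i x * ennreal ((norm (g x))\<^sup>2) \<partial>M) < \<infinity>"
      using g(2)[OF i] by (simp add: comp_funpow_in_L2_iff)
    then have "AE x in M. h i x * ennreal ((norm (g x))\<^sup>2) \<noteq> \<infinity>"
      by (intro nn_integral_PInf_AE) auto
    then have le: "AE x in M. indicator A x \<le> (norm (f x - g x))\<^sup>2"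
    proof eventually_elim
      case (elim x)
      show ?case
      proof (cases "x \<in> A")
        case True
        \<comment> \<open>On \<open>A\<close> the factor \<open>h i x\<close> is infinite, so the
          product stays finite only if the other factor is 0.\<close>
        then have "g x = 0" using elim by (auto simp: A_def ennreal_top_mult split: if_splits)
        then show ?thesis using norm_f[of x] by simp
      qed simp
    qed
    \<comment> \<open>A non-integrable function has Bochner integral 0, so the comparison of
      integrals below requires this.\<close>
    have int: "integrable M (\<lambda>x. (norm (f x - g x))\<^sup>2)"
    proof (rule Bochner_Integration.integrable_bound)
      show "integrable M (\<lambda>x. 2 * (norm (f x))\<^sup>2 + 2 * (norm (g x))\<^sup>2)"
        using f g_L2 by (auto simp: L2_fun_def)
      have "(norm (f x - g x))\<^sup>2 \<le> 2 * (norm (f x))\<^sup>2 + 2 * (norm (g x))\<^sup>2" for x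
      proof -
        have "(norm (f x - g x))\<^sup>2 \<le> (norm (f x) + norm (g x))\<^sup>2"
          by (intro power_mono norm_triangle_ineq4) simp
        also have "\<dots> \<le> 2 * (norm (f x))\<^sup>2 + 2 * (norm (g x))\<^sup>2"
          using sum_squares_bound[of "norm (f x)" "norm (g x)"] by (simp add: power2_sum)
        finally show ?thesis .
      qed
      then show "AE x in M. norm ((norm (f x - g x))\<^sup>2) \<le>
          norm (2 * (norm (f x))\<^sup>2 + 2 * (norm (g x))\<^sup>2)"
        by simp
    qed measurable
    have "measure M A = (\<integral>x. indicator A x \<partial>M)" by simp
    also have "\<dots> \<le> (\<integral>x. (norm (f x - g x))\<^sup>2 \<partial>M)"
      using int le A_fin by (intro integral_mono_AE) auto
    finally have "sqrt (measure M A) \<le> L2_dist M (L2_class M f) G"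
      unfolding g(1) L2_dist_class[OF f g_L2] by simp
    with G(2) show False by simp
  qed
  then have "AE x in M. \<forall>j. x \<in> F j \<longrightarrow> h i x < \<infinity>" by (subst AE_all_countable) blast
  then show ?thesis using AE_space by eventually_elim (use F(2) in blast)
qed

lemma h_finite:
  assumes le: "AE x in M. h 2 x \<le> 2 * h 1 x" and fin: "AE x in M. h 1 x < \<infinity>"
  shows "AE x in M. h n x < \<infinity>"
proof (induction n rule: less_induct)
  case (less n)
  show ?case
  proof (cases "n \<le> 1")
    case True
    then consider "n = 0" | "n = 1" by linarith
    then show ?thesis using fin by cases (auto simp: h_deriv_def)
  next
    case False
    define i where "i = n - 2"
    have n: "n = i + 2" using False by (simp add: i_def)
    have "AE x in M. h l x < \<infinity>" if "l \<le> i + 1" for l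
      using less that n by simp
    then obtain A :: "nat \<Rightarrow> 'a set" where A: "\<And>j. A j \<in> sets M" "AE x in M. \<exists>j. x \<in> A j"
      "\<And>l j. l \<le> i + 1 \<Longrightarrow> (\<integral>\<^sup>+x. h l x * indicator (A j) x \<partial>M) < \<infinity>"
      using exhaustion[of "i + 1"] by blast
    have "AE x in M. x \<in> A j \<longrightarrow> h n x < \<infinity>" for j
    proof -
      have [measurable]: "A j \<in> sets M" by (rule A(1))
      \<comment> \<open>Both sides of \<open>shift\<close> equal the integral of the indicator of
        \<open>A j\<close> along \<open>\<phi> ^^ (i + l)\<close>. With \<open>l = 2\<close> and
        \<open>l = 1\<close>, the bound on \<open>h 2\<close> compares \<open>h (i + 2)\<close> with
        \<open>h (i + 1)\<close> on \<open>A j\<close>.\<close>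
      define g :: "'a \<Rightarrow> ennreal" where "g x = indicator (A j) ((\<phi> ^^ i) x)" for x
      have [measurable]: "g \<in> borel_measurable M" unfolding g_def by measurable
      have shift: "(\<integral>\<^sup>+x. h (i + l) x * indicator (A j) x \<partial>M) = (\<integral>\<^sup>+x. h l x * g x \<partial>M)" for l
        using nn_integral_funpow[of "indicator (A j)" "i + l"] nn_integral_funpow[of g l]
        by (simp add: g_def funpow_add)
      have "(\<integral>\<^sup>+x. h n x * indicator (A j) x \<partial>M) \<le> (\<integral>\<^sup>+x. 2 * (h 1 x * g x) \<partial>M)"
        unfolding n shift using le
        by (intro nn_integral_mono_AE)
          (auto elim!: eventually_mono simp: mult.assoc[symmetric] intro!: mult_right_mono)
      also have "\<dots> = 2 * (\<integral>\<^sup>+x. h (i + 1) x * indicator (A j) x \<partial>M)"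
        unfolding shift by (rule nn_integral_cmult) measurable
      also have "\<dots> < \<infinity>"
        using A(3)[of "i + 1" j] by (simp add: ennreal_mult_less_top)
      finally have "AE x in M. h n x * indicator (A j) x \<noteq> \<infinity>"
        by (intro nn_integral_PInf_AE) auto
      then show ?thesis by eventually_elim (auto simp: less_top)
    qed
    then have "AE x in M. \<forall>j. x \<in> A j \<longrightarrow> h n x < \<infinity>" by (subst AE_all_countable) blast
    with A(2) show ?thesis by eventually_elim blast
  qed
qed

lemma Delta_h_nonpos:
  assumes "\<And>i. i \<le> n \<Longrightarrow> AE x in M. h i x < \<infinity>"
    and "\<And>F. F \<in> dom (C_power n) \<Longrightarrow> Theta (L2 M) (L2_norm M) (comp_op M \<phi>) n F \<le> 0"
  shows "AE x in M. Delta_h M \<phi> n x \<le> 0"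
  using alternating_sum_nonpos[of 0 n] assms by (simp add: Delta_h_def)

lemma h_finite_of_Theta_2_nonpos:
  assumes fin: "\<And>i. i \<le> 2 \<Longrightarrow> AE x in M. h i x < \<infinity>"
    and Theta: "\<And>F. F \<in> dom (C_power 2) \<Longrightarrow> Theta (L2 M) (L2_norm M) (comp_op M \<phi>) 2 F \<le> 0"
  shows "AE x in M. h n x < \<infinity>"
proof (rule h_finite)
  show "AE x in M. h 1 x < \<infinity>" using fin by simp
  moreover have "AE x in M. h 2 x < \<infinity>" using fin by simp
  moreover have "AE x in M. Delta_h M \<phi> 2 x \<le> 0" using Delta_h_nonpos fin Theta by blast
  ultimately show "AE x in M. h 2 x \<le> 2 * h 1 x"
  proof eventually_elim
    case (elim x)
    \<comment> \<open>Expanding \<open>Delta_h\<close> gives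
      \<open>1 - 2 * hr 1 x + hr 2 x \<le> 0\<close>, and the 1 is dropped. Finiteness then lifts
      the bound back to \<open>ennreal\<close>.\<close>
    have "hr 2 x \<le> 2 * hr 1 x"
      using elim by (simp add: Delta_h_def numeral_2_eq_2) (simp add: h_deriv_def)
    then have "ennreal (hr 2 x) \<le> ennreal (2 * hr 1 x)" by (rule ennreal_leI)
    then show ?case using elim by (simp add: ennreal_mult)
  qed
qed

end

section \<open>The two characterisations\<close>

theorem corollary2p13:
  fixes M :: "'a measure" and \<phi> :: "'a \<Rightarrow> 'a" and k :: nat
  assumes "sigma_finite_measure M"
    and "\<phi> \<in> M \<rightarrow>\<^sub>M M"
    and "absolutely_continuous M (distr M M \<phi>)"
    and "L2_dense M (dom (op_power (L2 M) (comp_op M \<phi>) 2))"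
    and "k \<ge> 1"
  shows "(k_hyperexpansive (L2 M) (L2_norm M) (comp_op M \<phi>) k \<longleftrightarrow>
            (\<forall>i\<in>{1..k}. Delta_h_defined M \<phi> i \<and> (AE x in M. Delta_h M \<phi> i x \<le> 0)))
       \<and> (completely_hyperexpansive (L2 M) (L2_norm M) (comp_op M \<phi>) \<longleftrightarrow>
            (AE x in M. (\<forall>i. h_deriv M \<phi> i x < \<infinity>) \<and>
                        completely_alternating (\<lambda>i. enn2real (h_deriv M \<phi> i x))))"
proof (intro conjI iffI)
  interpret sigma_finite_measure M by fact
  interpret nonsingular_map M \<phi>
    by unfold_locales (use assms(2,3) in auto)
  let ?Th = "Theta (L2 M) (L2_norm M) (comp_op M \<phi>)"
  have fin2: "AE x in M. h i x < \<infinity>" if "i \<le> 2" for i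
    using dense_dom_C_power_imp_h_finite[OF assms(4) that] .
  {
    assume hyp: "k_hyperexpansive (L2 M) (L2_norm M) (comp_op M \<phi>) k"
    have fin: "AE x in M. h i x < \<infinity>" if "i \<le> k" for i
    \<comment> \<open>For \<open>k = 1\<close> the form of order 2 has no known sign, but density
      already covers \<open>h 1\<close>; for larger \<open>k\<close> it is available and propagates
      finiteness.\<close>
    proof (cases "k = 1")
      case True
      then show ?thesis using fin2 that by simp
    next
      case False
      then have "2 \<in> {1..k}" using \<open>k \<ge> 1\<close> by simp
      then have "?Th 2 F \<le> 0" if "F \<in> dom (C_power 2)" for F
        using hyp that unfolding k_hyperexpansive_def by blast
      then show ?thesis using h_finite_of_Theta_2_nonpos fin2 by blast
    qed
    show "\<forall>i\<in>{1..k}. Delta_h_defined M \<phi> i \<and> (AE x in M. Delta_h M \<phi> i x \<le> 0)"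
    proof (intro ballI conjI)
      fix i assume i: "i \<in> {1..k}"
      show "Delta_h_defined M \<phi> i" using fin i by (simp add: Delta_h_defined_def)
      show "AE x in M. Delta_h M \<phi> i x \<le> 0"
        using fin hyp i unfolding k_hyperexpansive_def by (intro Delta_h_nonpos) auto
    qed
  next
    assume "\<forall>i\<in>{1..k}. Delta_h_defined M \<phi> i \<and> (AE x in M. Delta_h M \<phi> i x \<le> 0)"
    then show "k_hyperexpansive (L2 M) (L2_norm M) (comp_op M \<phi>) k"
      unfolding k_hyperexpansive_def using Theta_nonpos by blast
  next
    assume "completely_hyperexpansive (L2 M) (L2_norm M) (comp_op M \<phi>)"
    then have Th: "?Th n F \<le> 0" if "n \<ge> 1" "F \<in> dom (C_power n)" for n F
      using that unfolding completely_hyperexpansive_def by blast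
    have fin: "AE x in M. h i x < \<infinity>" for i
      using h_finite_of_Theta_2_nonpos fin2 Th[of 2] by simp
    \<comment> \<open>The exceptional null set depends on \<open>m\<close> and \<open>n\<close>;
      countably many pairs allow a common one, on which the whole sequence is completely
      alternating.\<close>
    have "AE x in M. n \<ge> 1 \<longrightarrow>
        (\<Sum>i\<le>n. (-1) ^ i * real (n choose i) * hr (m + i) x) \<le> 0" for m n
      using alternating_sum_nonpos[OF fin Th, of n m] by (cases "n \<ge> 1") auto
    then show "AE x in M. (\<forall>i. h i x < \<infinity>) \<and> completely_alternating (\<lambda>i. hr i x)"
      unfolding completely_alternating_def using fin by (simp add: AE_all_countable)
  next
    assume ae: "AE x in M. (\<forall>i. h i x < \<infinity>) \<and> completely_alternating (\<lambda>i. hr i x)"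
    show "completely_hyperexpansive (L2 M) (L2_norm M) (comp_op M \<phi>)"
      unfolding completely_hyperexpansive_def
    proof (intro allI impI ballI)
      fix n :: nat and F assume n: "n \<ge> 1" and F: "F \<in> dom (C_power n)"
      have "AE x in M. h i x < \<infinity>" for i using ae by eventually_elim simp
      then have "Delta_h_defined M \<phi> n" by (simp add: Delta_h_defined_def)
      moreover have "AE x in M. Delta_h M \<phi> n x \<le> 0"
        using ae
      proof eventually_elim
        case (elim x)
        \<comment> \<open>The instance \<open>m = 0\<close> of complete alternation is the sign of
          \<open>Delta_h\<close>.\<close>
        then have "(\<Sum>i\<le>n. (-1) ^ i * real (n choose i) * hr (0 + i) x) \<le> 0"
          using n unfolding completely_alternating_def by blast
        then show ?case by (simp add: Delta_h_def)
      qed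
      ultimately show "?Th n F \<le> 0" by (rule Theta_nonpos[OF F])
    qed
  }
qed

end
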